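(* Let $\mathscr G$ be an ample groupoid and $K$ a commutative ring with unit. The $K$-algebra $K\mathscr G$ is unital if and only if $\mathscr G^0$ is compact.
   Context: A groupoid is a small category with all arrows invertible; objects are identified with the corresponding units, $\mathscr G^0$ is the unit space, $d(g)=g^{-1}g$, $r(g)=gg^{-1}$, and $gh$ is defined iff $d(g)=r(h)$. A topological groupoid is a groupoid with a topology making the product and inversion continuous (composable pairs carrying the topology induced from the product topology). "Compact" means Hausdorff with the Heine-Borel property; a locally compact space need not be Hausdorff. An étale groupoid is a topological groupoid $\mathscr G$ that is locally compact (not necessarily Hausdorff), with $\mathscr G^0$ locally compact Hausdorff in the induced topology and $d\colon\mathscr G\to\mathscr G^0$ a local homeomorphism. A slice is an open subset $U\subseteq\mathscr G$ with $d|_U$ and $r|_U$ injective. $\mathscr G$ is ample if it is étale and the compact slices form a basis of its topology. Give $K$ the discrete topology. $K\mathscr G$ is the $K$-module of functions $\mathscr G\to K$ spanned by those $f$ for which there is an open Hausdorff subspace $V$ of $\mathscr G$ such that $f$ vanishes outside $V$ and $f|_V$ is continuous with compact support. It is a (not necessarily unital) $K$-algebra under the convolution $f\ast g(x)=\sum_{y\in d^{-1}(d(x))}f(xy^{-1})g(y)$.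
   Formalization: The commutative ring with unit K is assumed to be nonzero (0 ≠ 1); over the zero ring the algebra is trivially unital even when the unit space is not compact, so the claim fails there. *)

theory Defs
  imports "HOL-Analysis.Analysis" "HOL-Library.Function_Algebras"
begin

section \<open>Topological preliminaries\<close>

text \<open>
  Compactness includes the Hausdorff property, local compactness does not.  As the compact
  neighbourhoods are themselves Hausdorff, asking each point for one of them is the same as asking
  for a neighbourhood basis of them.
\<close>

definition compact_hausdorff_in :: "'a topology \<Rightarrow> 'a set \<Rightarrow> bool" where
  "compact_hausdorff_in X S \<longleftrightarrow> compactin X S \<and> Hausdorff_space (subtopology X S)"

definition locally_compact :: "'a topology \<Rightarrow> bool" where
  "locally_compact X \<longleftrightarrow>
     (\<forall>x\<in>topspace X. \<exists>U C. openin X U \<and> x \<in> U \<and> U \<subseteq> C \<and> compact_hausdorff_in X C)"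

definition local_homeomorphic_map :: "'a topology \<Rightarrow> 'b topology \<Rightarrow> ('a \<Rightarrow> 'b) \<Rightarrow> bool" where
  "local_homeomorphic_map X Y f \<longleftrightarrow>
     (\<forall>x\<in>topspace X. \<exists>U. openin X U \<and> x \<in> U \<and> openin Y (f ` U) \<and>
        homeomorphic_map (subtopology X U) (subtopology Y (f ` U)) f)"


section \<open>Groupoids\<close>

text \<open>
  A small category is given by its arrows alone, each object being identified with its identity
  arrow; so domain and range are maps from arrows to arrows.  The product \<open>comp_of G g h\<close> is
  meaningful only when the domain of \<open>g\<close> is the range of \<open>h\<close>.
\<close>

record 'g groupoid =
  arrows :: "'g set"
  dom_of :: "'g \<Rightarrow> 'g"
  ran_of :: "'g \<Rightarrow> 'g"
  comp_of :: "'g \<Rightarrow> 'g \<Rightarrow> 'g"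

definition unit_space :: "('g, 'm) groupoid_scheme \<Rightarrow> 'g set" where
  "unit_space G = dom_of G ` arrows G"

definition composable_pairs :: "('g, 'm) groupoid_scheme \<Rightarrow> ('g \<times> 'g) set" where
  "composable_pairs G = {(g, h). g \<in> arrows G \<and> h \<in> arrows G \<and> dom_of G g = ran_of G h}"

definition is_inverse :: "('g, 'm) groupoid_scheme \<Rightarrow> 'g \<Rightarrow> 'g \<Rightarrow> bool" where
  "is_inverse G g h \<longleftrightarrow> h \<in> arrows G \<and> dom_of G h = ran_of G g \<and> ran_of G h = dom_of G g \<and>
     comp_of G h g = dom_of G g \<and> comp_of G g h = ran_of G g"

definition inv_of :: "('g, 'm) groupoid_scheme \<Rightarrow> 'g \<Rightarrow> 'g" where
  "inv_of G g = (THE h. is_inverse G g h)"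

locale groupoid =
  fixes G :: "('g, 'm) groupoid_scheme"
  assumes dom_closed: "g \<in> arrows G \<Longrightarrow> dom_of G g \<in> arrows G"
    and ran_closed: "g \<in> arrows G \<Longrightarrow> ran_of G g \<in> arrows G"
    and dom_dom: "g \<in> arrows G \<Longrightarrow> dom_of G (dom_of G g) = dom_of G g"
    and ran_dom: "g \<in> arrows G \<Longrightarrow> ran_of G (dom_of G g) = dom_of G g"
    and dom_ran: "g \<in> arrows G \<Longrightarrow> dom_of G (ran_of G g) = ran_of G g"
    and ran_ran: "g \<in> arrows G \<Longrightarrow> ran_of G (ran_of G g) = ran_of G g"
    and comp_closed: "(g, h) \<in> composable_pairs G \<Longrightarrow> comp_of G g h \<in> arrows G"
    and dom_comp: "(g, h) \<in> composable_pairs G \<Longrightarrow> dom_of G (comp_of G g h) = dom_of G h"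
    and ran_comp: "(g, h) \<in> composable_pairs G \<Longrightarrow> ran_of G (comp_of G g h) = ran_of G g"
    and comp_dom: "g \<in> arrows G \<Longrightarrow> comp_of G g (dom_of G g) = g"
    and ran_comp_self: "g \<in> arrows G \<Longrightarrow> comp_of G (ran_of G g) g = g"
    and comp_assoc: "\<lbrakk>(g, h) \<in> composable_pairs G; (h, k) \<in> composable_pairs G\<rbrakk> \<Longrightarrow>
           comp_of G (comp_of G g h) k = comp_of G g (comp_of G h k)"
    and invertible: "g \<in> arrows G \<Longrightarrow> \<exists>h. is_inverse G g h"
begin

lemma is_inverse_unique:
  assumes g: "g \<in> arrows G" and h: "is_inverse G g h" and k: "is_inverse G g k"
  shows "h = k"
proof -
  have hg: "(h, g) \<in> composable_pairs G" and gk: "(g, k) \<in> composable_pairs G"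
    using g h k by (auto simp: is_inverse_def composable_pairs_def)
  have "h = comp_of G h (comp_of G g k)"
    using h k by (metis comp_dom is_inverse_def)
  also have "\<dots> = comp_of G (comp_of G h g) k"
    using comp_assoc[OF hg gk] by simp
  also have "\<dots> = k"
    using h k by (metis ran_comp_self is_inverse_def)
  finally show ?thesis .
qed

lemma is_inverse_inv_of: "g \<in> arrows G \<Longrightarrow> is_inverse G g (inv_of G g)"
  unfolding inv_of_def using invertible is_inverse_unique by (metis theI)

lemma dom_of_eq: "g \<in> arrows G \<Longrightarrow> dom_of G g = comp_of G (inv_of G g) g"
  using is_inverse_inv_of by (simp add: is_inverse_def)

lemma ran_of_eq: "g \<in> arrows G \<Longrightarrow> ran_of G g = comp_of G g (inv_of G g)"
  using is_inverse_inv_of by (simp add: is_inverse_def)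

end

record 'g top_groupoid = "'g groupoid" +
  topology_of :: "'g topology"

locale topological_groupoid = groupoid G
  for G :: "('g, 'm) top_groupoid_scheme" +
  assumes topspace_topology_of: "topspace (topology_of G) = arrows G"
    and continuous_comp:
      "continuous_map
         (subtopology (prod_topology (topology_of G) (topology_of G)) (composable_pairs G))
         (topology_of G) (\<lambda>(g, h). comp_of G g h)"
    and continuous_inv: "continuous_map (topology_of G) (topology_of G) (inv_of G)"

abbreviation unit_topology :: "('g, 'm) top_groupoid_scheme \<Rightarrow> 'g topology" where
  "unit_topology G \<equiv> subtopology (topology_of G) (unit_space G)"

locale etale_groupoid = topological_groupoid +
  assumes locally_compact_arrows: "locally_compact (topology_of G)"
    and locally_compact_units: "locally_compact (unit_topology G)"
    and Hausdorff_units: "Hausdorff_space (unit_topology G)"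
    and local_homeomorphic_dom: "local_homeomorphic_map (topology_of G) (unit_topology G) (dom_of G)"

definition slice :: "('g, 'm) top_groupoid_scheme \<Rightarrow> 'g set \<Rightarrow> bool" where
  "slice G U \<longleftrightarrow> openin (topology_of G) U \<and> inj_on (dom_of G) U \<and> inj_on (ran_of G) U"

definition compact_slice :: "('g, 'm) top_groupoid_scheme \<Rightarrow> 'g set \<Rightarrow> bool" where
  "compact_slice G U \<longleftrightarrow> slice G U \<and> compact_hausdorff_in (topology_of G) U"

locale ample_groupoid = etale_groupoid +
  assumes compact_slices_basis: "openin (topology_of G) = arbitrary union_of compact_slice G"


section \<open>The groupoid algebra\<close>

text \<open>
  Functions on the groupoid are represented by their extensions by zero to the whole type; all
  the spanning functions vanish outside an open subspace, hence outside the groupoid.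
\<close>

definition scale_fun :: "'k::comm_ring_1 \<Rightarrow> ('g \<Rightarrow> 'k) \<Rightarrow> 'g \<Rightarrow> 'k" where
  "scale_fun c f = (\<lambda>x. c * f x)"

interpretation scale_fun: module scale_fun
  by unfold_locales (auto simp: scale_fun_def fun_eq_iff algebra_simps)

definition spanning_functions :: "('g, 'm) top_groupoid_scheme \<Rightarrow> ('g \<Rightarrow> 'k::comm_ring_1) set" where
  "spanning_functions G =
     {f. \<exists>V. openin (topology_of G) V \<and> Hausdorff_space (subtopology (topology_of G) V) \<and>
           (\<forall>x. x \<notin> V \<longrightarrow> f x = 0) \<and>
           continuous_map (subtopology (topology_of G) V) (discrete_topology UNIV) f \<and>
           compact_hausdorff_in (subtopology (topology_of G) V)
             (subtopology (topology_of G) V closure_of {x \<in> V. f x \<noteq> 0})}"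

definition groupoid_algebra :: "('g, 'm) top_groupoid_scheme \<Rightarrow> ('g \<Rightarrow> 'k::comm_ring_1) set" where
  "groupoid_algebra G = scale_fun.span (spanning_functions G)"

text \<open>
  The fibre of the domain map may be infinite, so the sum is taken over the support of the
  summand, which is finite by the lemma \<open>finite_convolution_support\<close> below.
\<close>

definition convolution ::
    "('g, 'm) groupoid_scheme \<Rightarrow> ('g \<Rightarrow> 'k::comm_ring_1) \<Rightarrow> ('g \<Rightarrow> 'k) \<Rightarrow> 'g \<Rightarrow> 'k" where
  "convolution G f g = (\<lambda>x. if x \<in> arrows G then
      supp_sum (\<lambda>y. f (comp_of G x (inv_of G y)) * g y)
        {y \<in> arrows G. dom_of G y = dom_of G x}
     else 0)"

definition unital :: "'a set \<Rightarrow> ('a \<Rightarrow> 'a \<Rightarrow> 'a) \<Rightarrow> bool" where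
  "unital A mul \<longleftrightarrow> (\<exists>e\<in>A. \<forall>f\<in>A. mul e f = f \<and> mul f e = f)"

context etale_groupoid
begin

lemma finite_fibre_support_spanning:
  fixes f :: "'a \<Rightarrow> 'k::comm_ring_1"
  assumes "f \<in> spanning_functions G"
  shows "finite {y \<in> arrows G. dom_of G y = u \<and> f y \<noteq> 0}"
proof -
  let ?T = "topology_of G"
  obtain V where V: "openin ?T V" "\<forall>x. x \<notin> V \<longrightarrow> f x = 0"
    and C: "compactin (subtopology ?T V) (subtopology ?T V closure_of {x \<in> V. f x \<noteq> 0})"
    using assms unfolding spanning_functions_def compact_hausdorff_in_def by blast
  define C where "C = subtopology ?T V closure_of {x \<in> V. f x \<noteq> 0}"
  have comp: "compactin ?T C"
    using C by (simp add: C_def compactin_subtopology)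
  have supp: "{x. f x \<noteq> 0} \<subseteq> C"
    using V openin_subset[OF V(1)]
    by (auto simp: C_def intro!: subsetD[OF closure_of_subset])
  define \<U> where "\<U> = {U. openin ?T U \<and> inj_on (dom_of G) U}"
  have cover: "C \<subseteq> \<Union>\<U>"
  proof
    fix x assume "x \<in> C"
    then have "x \<in> topspace ?T" using compactin_subset_topspace[OF comp] by blast
    then obtain U where U: "openin ?T U" "x \<in> U"
        "homeomorphic_map (subtopology ?T U) (subtopology (unit_topology G) (dom_of G ` U)) (dom_of G)"
      using local_homeomorphic_dom unfolding local_homeomorphic_map_def by blast
    then have "inj_on (dom_of G) U"
      using homeomorphic_imp_injective_map[OF U(3)] openin_subset[OF U(1)]
      by (simp add: Int_absorb1)
    then show "x \<in> \<Union>\<U>" using U by (auto simp: \<U>_def)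
  qed
  obtain \<F> where F: "finite \<F>" "\<F> \<subseteq> \<U>" "C \<subseteq> \<Union>\<F>"
    using comp cover unfolding compactin_def \<U>_def by (smt (verit) mem_Collect_eq)
  have fin: "finite {y \<in> U. dom_of G y = u}" if "U \<in> \<F>" for U
  proof (rule finite_imageD[of "dom_of G"])
    show "finite (dom_of G ` {y \<in> U. dom_of G y = u})"
      by (rule finite_subset[of _ "{u}"]) auto
    show "inj_on (dom_of G) {y \<in> U. dom_of G y = u}"
      using that F(2) by (auto simp: \<U>_def inj_on_def)
  qed
  have "{y \<in> arrows G. dom_of G y = u \<and> f y \<noteq> 0} \<subseteq> (\<Union>U\<in>\<F>. {y \<in> U. dom_of G y = u})"
    using supp F(3) by blast
  then show ?thesis using fin F(1) finite_subset by blast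
qed

lemma finite_fibre_support:
  fixes f :: "'a \<Rightarrow> 'k::comm_ring_1"
  assumes "f \<in> groupoid_algebra G"
  shows "finite {y \<in> arrows G. dom_of G y = u \<and> f y \<noteq> 0}"
  using assms unfolding groupoid_algebra_def
proof (induction rule: scale_fun.span_induct_alt)
  case base
  show ?case by simp
next
  case (step c f g)
  have "{y \<in> arrows G. dom_of G y = u \<and> (scale_fun c f + g) y \<noteq> 0} \<subseteq>
      {y \<in> arrows G. dom_of G y = u \<and> f y \<noteq> 0} \<union> {y \<in> arrows G. dom_of G y = u \<and> g y \<noteq> 0}"
    by (auto simp: scale_fun_def)
  then show ?case
    using finite_fibre_support_spanning[OF step(1)] step(2) finite_subset by blast
qed

lemma finite_convolution_support:
  fixes f g :: "'a \<Rightarrow> 'k::comm_ring_1"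
  assumes "g \<in> groupoid_algebra G"
  shows "finite (support_on {y \<in> arrows G. dom_of G y = dom_of G x}
           (\<lambda>y. f (comp_of G x (inv_of G y)) * g y))"
  by (rule finite_subset[OF _ finite_fibre_support[OF assms, of "dom_of G x"]])
     (auto simp: support_on_def)

end

end

theory Submission
  imports Defs
begin

text \<open>
  The unit space is open, because the domain map is locally injective and fixes the units.  If it
  is compact, its indicator function therefore lies in the algebra, and it is a two-sided
  identity.  Conversely, convolving an identity with the indicator functions of the compact open
  sets of units, which cover the unit space, shows that it takes the value 1 on every unit.  The
  support of an element of the algebra lies in a compact set, and the image of this
  compact set under the domain map is the unit space.
\<close>

text \<open>Evaluates a convolution of which a single term survives. Since \<open>supp_sum\<close>
  sums over the support only, \<open>A\<close> may be an infinite fibre of the domain map.\<close>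

lemma supp_sum_eq_single:
  assumes "\<And>y. \<lbrakk>y \<in> A; y \<noteq> a\<rbrakk> \<Longrightarrow> f y = 0"
  shows "supp_sum f A = (if a \<in> A then f a else 0)"
proof -
  have "support_on A f = (if a \<in> A \<and> f a \<noteq> 0 then {a} else {})"
    using assms by (auto simp: support_on_def)
  then show ?thesis
    by (simp add: supp_sum_def)
qed

section \<open>Units, inverses and convolution with indicators of sets of units\<close>

context groupoid
begin

lemma unit_space_subset_arrows: "unit_space G \<subseteq> arrows G"
  by (auto simp: unit_space_def dom_closed)

lemma dom_in_unit_space: "g \<in> arrows G \<Longrightarrow> dom_of G g \<in> unit_space G"
  by (simp add: unit_space_def)

lemma dom_unit: "u \<in> unit_space G \<Longrightarrow> dom_of G u = u"
  by (auto simp: unit_space_def dom_dom)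

lemma ran_unit: "u \<in> unit_space G \<Longrightarrow> ran_of G u = u"
  by (auto simp: unit_space_def ran_dom)

lemma ran_in_unit_space: "g \<in> arrows G \<Longrightarrow> ran_of G g \<in> unit_space G"
  using dom_in_unit_space[of "ran_of G g"] by (simp add: ran_closed dom_ran)

lemma inv_of_unit:
  assumes "u \<in> unit_space G"
  shows "inv_of G u = u"
proof -
  have u: "u \<in> arrows G"
    using assms unit_space_subset_arrows by blast
  then have "is_inverse G u u"
    using comp_dom[OF u] assms by (simp add: is_inverse_def dom_unit ran_unit)
  then show ?thesis
    using is_inverse_unique[OF u is_inverse_inv_of[OF u]] by blast
qed

lemma inv_of_closed: "g \<in> arrows G \<Longrightarrow> inv_of G g \<in> arrows G"
  using is_inverse_inv_of by (simp add: is_inverse_def)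

lemma inv_of_composable: "g \<in> arrows G \<Longrightarrow> (inv_of G g, g) \<in> composable_pairs G"
  using is_inverse_inv_of[of g] by (simp add: is_inverse_def composable_pairs_def)

text \<open>A unit equals its own domain, so the unit x y^{-1} is the range of y; multiplying by y
  on the right gives x = y. Thus only the term y = x survives when the indicator of the units is
  convolved from the left.\<close>

lemma eq_if_comp_inv_unit:
  assumes x: "x \<in> arrows G" and y: "y \<in> arrows G" and eq: "dom_of G y = dom_of G x"
    and unit: "comp_of G x (inv_of G y) \<in> unit_space G"
  shows "x = y"
proof -
  let ?z = "comp_of G x (inv_of G y)"
  have inv: "is_inverse G y (inv_of G y)"
    using y by (rule is_inverse_inv_of)
  have xy: "(x, inv_of G y) \<in> composable_pairs G"
    using inv x eq by (auto simp: is_inverse_def composable_pairs_def)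
  have "?z = ran_of G y"
    using dom_comp[OF xy] dom_unit[OF unit] inv by (simp add: is_inverse_def)
  then have "y = comp_of G ?z y"
    using ran_comp_self[OF y] by simp
  also have "\<dots> = comp_of G x (comp_of G (inv_of G y) y)"
    by (rule comp_assoc[OF xy inv_of_composable[OF y]])
  also have "\<dots> = x"
    using comp_dom[OF x] eq dom_of_eq[OF y] by simp
  finally show ?thesis ..
qed

text \<open>The fibre over \<open>dom_of G x\<close> contains just one unit,
  \<open>dom_of G x\<close> itself. Only this y can contribute, and there x y^{-1} = x.\<close>

lemma convolution_indicator_right:
  fixes f :: "'g \<Rightarrow> 'k::comm_ring_1"
  assumes U: "U \<subseteq> unit_space G" and x: "x \<in> arrows G"
  shows "convolution G f (indicator U) x = (if dom_of G x \<in> U then f x else 0)"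
proof -
  have unit: "dom_of G x \<in> unit_space G"
    using x by (rule dom_in_unit_space)
  have "convolution G f (indicator U) x =
      supp_sum (\<lambda>y. f (comp_of G x (inv_of G y)) * indicator U y)
        {y \<in> arrows G. dom_of G y = dom_of G x}"
    using x by (simp add: convolution_def)
  also have "\<dots> = (if dom_of G x \<in> {y \<in> arrows G. dom_of G y = dom_of G x}
      then f (comp_of G x (inv_of G (dom_of G x))) * indicator U (dom_of G x) else 0)"
    by (rule supp_sum_eq_single) (use U dom_unit in \<open>auto simp: indicator_def\<close>)
  also have "\<dots> = (if dom_of G x \<in> U then f x else 0)"
    using x unit by (simp add: dom_closed dom_dom inv_of_unit comp_dom)
  finally show ?thesis .
qed

text \<open>By \<open>eq_if_comp_inv_unit\<close> only y = x contributes, and x x^{-1} is the unit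
  \<open>ran_of G x\<close>.\<close>

lemma convolution_indicator_units_left:
  fixes f :: "'g \<Rightarrow> 'k::comm_ring_1"
  assumes x: "x \<in> arrows G"
  shows "convolution G (indicator (unit_space G)) f x = f x"
proof -
  have "convolution G (indicator (unit_space G)) f x =
      supp_sum (\<lambda>y. indicator (unit_space G) (comp_of G x (inv_of G y)) * f y)
        {y \<in> arrows G. dom_of G y = dom_of G x}"
    using x by (simp add: convolution_def)
  also have "\<dots> = (if x \<in> {y \<in> arrows G. dom_of G y = dom_of G x}
      then indicator (unit_space G) (comp_of G x (inv_of G x)) * f x else 0)"
    by (rule supp_sum_eq_single) (use eq_if_comp_inv_unit[OF x] in \<open>auto simp: indicator_def\<close>)
  also have "\<dots> = f x"
    using x ran_in_unit_space[OF x] by (simp add: ran_of_eq[symmetric])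
  finally show ?thesis .
qed

end

section \<open>Continuity of the domain map and openness of the unit space\<close>

context topological_groupoid
begin

text \<open>The domain is g^{-1} g, so the map is g \<mapsto> (g^{-1}, g) followed by the
  product.\<close>

lemma continuous_dom: "continuous_map (topology_of G) (topology_of G) (dom_of G)"
proof -
  let ?T = "topology_of G"
  have "continuous_map ?T (subtopology (prod_topology ?T ?T) (composable_pairs G))
      (\<lambda>g. (inv_of G g, g))"
    using continuous_inv inv_of_composable
    by (auto simp: continuous_map_in_subtopology topspace_topology_of
        intro!: continuous_map_pairedI)
  from continuous_map_compose[OF this continuous_comp] show ?thesis
    by (rule continuous_map_eq) (simp add: topspace_topology_of dom_of_eq)
qed

end

context etale_groupoid
begin

lemma openin_unit_space: "openin (topology_of G) (unit_space G)"
proof (subst openin_subopen, intro ballI)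
  let ?T = "topology_of G"
  fix u assume u: "u \<in> unit_space G"
  then have "u \<in> topspace ?T"
    using unit_space_subset_arrows topspace_topology_of by blast
  then obtain U where U: "openin ?T U" "u \<in> U"
      "homeomorphic_map (subtopology ?T U) (subtopology (unit_topology G) (dom_of G ` U)) (dom_of G)"
    using local_homeomorphic_dom unfolding local_homeomorphic_map_def by blast
  have inj: "inj_on (dom_of G) U"
    using homeomorphic_imp_injective_map[OF U(3)] openin_subset[OF U(1)]
    by (simp add: Int_absorb1)
  \<comment> \<open>For g in \<open>W\<close> both g and its domain lie in \<open>U\<close> and have
    the same domain, so injectivity on \<open>U\<close> makes g a unit.\<close>
  define W where "W = U \<inter> {g \<in> topspace ?T. dom_of G g \<in> U}"
  have "openin ?T W"
    unfolding W_def using U(1) openin_continuous_map_preimage[OF continuous_dom] by blast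
  moreover have "u \<in> W"
    using U(2) u \<open>u \<in> topspace ?T\<close> by (simp add: W_def dom_unit)
  moreover have "W \<subseteq> unit_space G"
  proof
    fix g assume g: "g \<in> W"
    then have "g \<in> arrows G" "g \<in> U" "dom_of G g \<in> U"
      by (auto simp: W_def topspace_topology_of)
    then have "dom_of G g = g"
      using inj by (metis dom_dom inj_onD)
    then show "g \<in> unit_space G"
      using dom_in_unit_space[OF \<open>g \<in> arrows G\<close>] by simp
  qed
  ultimately show "\<exists>W. openin ?T W \<and> u \<in> W \<and> W \<subseteq> unit_space G"
    by blast
qed

section \<open>Indicator functions in the algebra and supports of its elements\<close>

lemma indicator_in_groupoid_algebra:
  assumes U: "openin (topology_of G) U" "compact_hausdorff_in (topology_of G) U"
  shows "(indicator U :: 'a \<Rightarrow> 'k::comm_ring_1) \<in> groupoid_algebra G"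
proof -
  let ?S = "subtopology (topology_of G) U"
  have top: "topspace ?S = U"
    using openin_subset[OF U(1)] by auto
  have "continuous_map ?S (discrete_topology UNIV) (indicator U :: 'a \<Rightarrow> 'k)"
    by (rule continuous_map_eq[where f = "\<lambda>_. 1"]) (auto simp: top)
  moreover have "{x \<in> U. (indicator U x :: 'k) \<noteq> 0} = U"
    by auto
  \<comment> \<open>The closure is taken inside \<open>U\<close>, where \<open>U\<close> is the
    whole space; a compact set need not be closed in the possibly non-Hausdorff groupoid.\<close>
  moreover have "?S closure_of U = U"
    using closure_of_topspace[of ?S] by (simp only: top)
  moreover have "compact_hausdorff_in ?S U"
    using U(2) by (simp add: compact_hausdorff_in_def compactin_subtopology subtopology_subtopology)
  ultimately have "(indicator U :: 'a \<Rightarrow> 'k) \<in> spanning_functions G"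
    using U by (auto simp: spanning_functions_def compact_hausdorff_in_def intro!: exI[of _ U])
  then show ?thesis
    unfolding groupoid_algebra_def by (rule scale_fun.span_base)
qed

text \<open>Each spanning function has its support in a compact set, and finite unions of compact
  sets are compact. The Hausdorff property is not claimed for \<open>C\<close>, as such a union may
  lose it.\<close>

lemma groupoid_algebra_compact_support:
  fixes f :: "'a \<Rightarrow> 'k::comm_ring_1"
  assumes "f \<in> groupoid_algebra G"
  shows "\<exists>C. compactin (topology_of G) C \<and> {x. f x \<noteq> 0} \<subseteq> C"
  using assms unfolding groupoid_algebra_def
proof (induction rule: scale_fun.span_induct_alt)
  case base
  show ?case by (auto intro: exI[of _ "{}"])
next
  case (step c f g)
  let ?T = "topology_of G"
  obtain V where V: "openin ?T V" "\<forall>x. x \<notin> V \<longrightarrow> f x = 0"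
    and C: "compactin (subtopology ?T V) (subtopology ?T V closure_of {x \<in> V. f x \<noteq> 0})"
    using step(1) unfolding spanning_functions_def compact_hausdorff_in_def by blast
  define C where "C = subtopology ?T V closure_of {x \<in> V. f x \<noteq> 0}"
  have "compactin ?T C"
    using C by (simp add: C_def compactin_subtopology)
  moreover have "{x. f x \<noteq> 0} \<subseteq> C"
    using V openin_subset[OF V(1)]
    by (auto simp: C_def intro!: subsetD[OF closure_of_subset])
  moreover obtain D where "compactin ?T D" "{x. g x \<noteq> 0} \<subseteq> D"
    using step(2) by blast
  moreover have "{x. (scale_fun c f + g) x \<noteq> 0} \<subseteq> {x. f x \<noteq> 0} \<union> {x. g x \<noteq> 0}"
    by (auto simp: scale_fun_def)
  ultimately have "compactin ?T (C \<union> D)" "{x. (scale_fun c f + g) x \<noteq> 0} \<subseteq> C \<union> D"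
    using compactin_Un by blast+
  then show ?case by blast
qed

lemma groupoid_algebra_zero_outside:
  fixes f :: "'a \<Rightarrow> 'k::comm_ring_1"
  assumes "f \<in> groupoid_algebra G" "x \<notin> arrows G"
  shows "f x = 0"
  using groupoid_algebra_compact_support[OF assms(1)] assms(2) compactin_subset_topspace
  unfolding topspace_topology_of[symmetric] by blast

section \<open>The two implications\<close>

lemma unital_if_compact_units:
  assumes "compact_hausdorff_in (topology_of G) (unit_space G)"
  shows "unital (groupoid_algebra G :: ('a \<Rightarrow> 'k::comm_ring_1) set) (convolution G)"
  unfolding unital_def
proof (intro bexI ballI conjI)
  show "(indicator (unit_space G) :: 'a \<Rightarrow> 'k) \<in> groupoid_algebra G"
    using openin_unit_space assms by (rule indicator_in_groupoid_algebra)
next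
  fix f :: "'a \<Rightarrow> 'k" assume f: "f \<in> groupoid_algebra G"
  \<comment> \<open>Both sides vanish off the groupoid; arbitrary \<open>g\<close> and
    \<open>h\<close> let this serve both products.\<close>
  have outside: "convolution G g h x = f x" if "x \<notin> arrows G" for g h x
    using that groupoid_algebra_zero_outside[OF f that] by (simp add: convolution_def)
  show "convolution G (indicator (unit_space G)) f = f"
    using outside convolution_indicator_units_left by blast
  show "convolution G f (indicator (unit_space G)) = f"
  proof
    fix x
    show "convolution G f (indicator (unit_space G)) x = f x"
      using outside convolution_indicator_right[of "unit_space G" x f] dom_in_unit_space
      by (cases "x \<in> arrows G") auto
  qed
qed

end

context ample_groupoid
begin

lemma compact_units_if_unital:
  assumes "unital (groupoid_algebra G :: ('a \<Rightarrow> 'k::comm_ring_1) set) (convolution G)"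
  shows "compact_hausdorff_in (topology_of G) (unit_space G)"
proof -
  let ?T = "topology_of G"
  obtain e :: "'a \<Rightarrow> 'k" where e: "e \<in> groupoid_algebra G"
    and unit: "\<And>f. f \<in> groupoid_algebra G \<Longrightarrow> convolution G e f = f"
    using assms unfolding unital_def by blast
  have e_unit: "e u = 1" if u: "u \<in> unit_space G" for u
  proof -
    \<comment> \<open>Ampleness and openness of the unit space give \<open>u\<close> a compact open
      neighbourhood \<open>U\<close> of units, so that the indicator of \<open>U\<close> lies in the
      algebra. Evaluating its product with \<open>e\<close> at \<open>u\<close> gives e(u) =
      1.\<close>
    have "(arbitrary union_of compact_slice G) (unit_space G)"
      using openin_unit_space compact_slices_basis by simp
    then obtain U where U: "compact_slice G U" "u \<in> U" "U \<subseteq> unit_space G"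
      using u unfolding union_of_def arbitrary_def by blast
    have "(indicator U :: 'a \<Rightarrow> 'k) \<in> groupoid_algebra G"
      using U(1) by (auto simp: compact_slice_def slice_def intro: indicator_in_groupoid_algebra)
    then have "convolution G e (indicator U) u = indicator U u"
      by (simp add: unit)
    then show ?thesis
      using convolution_indicator_right[of U u e] U u unit_space_subset_arrows
      by (auto simp: dom_unit)
  qed
  obtain C where C: "compactin ?T C" "{x. e x \<noteq> 0} \<subseteq> C"
    using groupoid_algebra_compact_support[OF e] by blast
  have "unit_space G = dom_of G ` C"
  proof
    show "unit_space G \<subseteq> dom_of G ` C"
    proof
      fix u assume u: "u \<in> unit_space G"
      \<comment> \<open>Here 1 \<noteq> 0 in the coefficient ring, which is part of
        \<open>comm_ring_1\<close>.\<close>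
      then have "u \<in> C"
        using e_unit C(2) by auto
      then show "u \<in> dom_of G ` C"
        using dom_unit[OF u] by (metis imageI)
    qed
    show "dom_of G ` C \<subseteq> unit_space G"
      using compactin_subset_topspace[OF C(1)] dom_in_unit_space
      by (auto simp: topspace_topology_of)
  qed
  \<comment> \<open>\<open>C\<close> may contain arrows that are not units; passing to the image
    under the domain map leaves exactly the units and preserves compactness.\<close>
  then have "compactin ?T (unit_space G)"
    using image_compactin[OF C(1) continuous_dom] by simp
  then show ?thesis
    using Hausdorff_units by (simp add: compact_hausdorff_in_def)
qed

end

theorem proposition3p12:
  fixes G :: "'g top_groupoid"
  assumes "ample_groupoid G"
  shows "unital (groupoid_algebra G :: ('g \<Rightarrow> 'k::comm_ring_1) set) (convolution G) \<longleftrightarrow>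
    compact_hausdorff_in (topology_of G) (unit_space G)"
proof -
  interpret ample_groupoid G
    by (fact assms)
  show ?thesis
    using compact_units_if_unital unital_if_compact_units by blast
qed

end
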